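(* For every $a\in\mathbb{C}$ with $\tfrac43-a\notin\{0,-1,-2,\dots\}$, $$F\!\left(a,a+\tfrac13;\tfrac43-a;-\tfrac54+\tfrac34\sqrt3\right)=\frac{3^{-9a/4}\,\Gamma(\tfrac34)\,\Gamma(\tfrac{13}{12})\,\Gamma(\tfrac23-\tfrac12a)\,\Gamma(\tfrac76-\tfrac12a)}{2^{-7a/2}\,\Gamma(\tfrac23)\,\Gamma(\tfrac76)\,\Gamma(\tfrac34-\tfrac12a)\,\Gamma(\tfrac{13}{12}-\tfrac12a)}.$$
   Context: $F(a,b;c;x)=\sum_{n\ge0}\frac{(a,n)(b,n)}{(c,n)(1,n)}x^n$ with $(\alpha,n)=\Gamma(\alpha+n)/\Gamma(\alpha)$ is the Gauss hypergeometric series. $1/\Gamma$ is interpreted as $0$ at the poles of $\Gamma$. *)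

theory Defs
  imports "HOL-Analysis.Analysis"
begin

(* The symbol (alpha, n) = Gamma (alpha + n) / Gamma alpha is rendered as pochhammer alpha n.
   The two agree when alpha is not a non-positive integer (pochhammer_Gamma); at non-positive
   integers alpha the Pochhammer symbol is the limiting value, so the series then terminates
   if a or b is such an integer. *)

definition hyp2F1 :: "complex \<Rightarrow> complex \<Rightarrow> complex \<Rightarrow> complex \<Rightarrow> complex" where
  "hyp2F1 a b c x =
     (\<Sum>n. pochhammer a n * pochhammer b n / (pochhammer c n * pochhammer 1 n) * x ^ n)"

lemma hyp2F1_eq_eval_fps: "hyp2F1 a b c x = eval_fps (fps_hypergeo [a, b] [c] 1) x"
  by (simp add: hyp2F1_def eval_fps_def flip: pochhammer_fact)

(* In the statement, 1 / Gamma at arguments that may be poles of Gamma is the entire function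
   rGamma, which is 0 at those poles. *)

end

theory Submission
  imports Defs "HOL-Complex_Analysis.Complex_Analysis"
begin

text \<open>
  The exponent differences of \<open>F(a, a + 1/3; 4/3 - a; x)\<close> at \<open>0\<close>, \<open>1\<close>, \<open>\<infinity>\<close> are, up to sign,
  \<open>a - 1/3\<close>, \<open>3 (a - 1/3)\<close>, \<open>1/3\<close>.  This is the pattern that arises when a hypergeometric equation with
  differences \<open>a - 1/3\<close>, \<open>1/2\<close>, \<open>1/3\<close> is pulled back along the quartic map
    \<open>\<phi>(x) = 64 x (1 - x)^3 / (1 + 8 x)^3\<close>,  \<open>1 - \<phi>(x) = (1 - 20 x - 8 x^2)^2 / (1 + 8 x)^3\<close>:
  the triple zero at \<open>x = 1\<close> triples the difference, the triple pole at \<open>x = -1/8\<close> turns \<open>1/3\<close> into an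
  ordinary point, and so do the double points over \<open>1\<close> with the difference \<open>1/2\<close>.  Comparing exponents
  leads to the classical (Goursat) transformation
    \<open>F(a, a + 1/3; 4/3 - a; x)
       = (1 - x)^(1 - 3 a) (1 + 8 x)^(3 a/2 - 3/4) F(1/4 - a/2, 7/12 - a/2; 4/3 - a; \<phi>(x))\<close>.
  The number \<open>-5/4 + 3/4 sqrt 3\<close> is the positive root of \<open>1 - 20 x - 8 x^2\<close>, so \<open>\<phi>\<close> takes the value
  \<open>1\<close> there and Gauss's theorem sums the series on the right.
  
  The transformation holds near \<open>0\<close> because the right-hand side satisfies the hypergeometric equation
  (\<open>pullback_ode\<close>), which has only one power series solution with constant term \<open>1\<close> when \<open>c\<close> is not a
  non-positive integer (\<open>hyp2F1_has_fps_expansionI\<close>).  Analytic continuation carries it along the real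
  segment up to the root (\<open>hyp2F1_eq_pullback\<close>), and since \<open>c - a - b = 1/2\<close> on the right, the series
  converges absolutely on the closed unit disc, so that the limit at the root may be taken
  (\<open>hyp2F1_at_x0\<close>).  Gauss's theorem (\<open>Gauss_summation\<close>) and the duplication formula then produce the
  Gamma factors; the exponential factor comes from \<open>3 sqrt 3 (1 + 8 x) = 8 (1 - x)^2\<close> at the root.
  The remaining constant is independent of \<open>a\<close> and is found by setting \<open>a = 0\<close>, where the series is \<open>1\<close>.
\<close>

section \<open>The hypergeometric equation\<close>

text \<open>
  The differential operator \<open>x (1 - x) D^2 + (c - (a + b + 1) x) D - a b\<close> on formal power series.
\<close>
definition fps_hyp_op :: "complex \<Rightarrow> complex \<Rightarrow> complex \<Rightarrow> complex fps \<Rightarrow> complex fps" where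
  "fps_hyp_op a b c f = fps_X * (1 - fps_X) * fps_deriv (fps_deriv f)
     + (fps_const c - fps_const (a + b + 1) * fps_X) * fps_deriv f - fps_const (a * b) * f"

lemma fps_nth_hyp_op:
  "fps_nth (fps_hyp_op a b c f) n =
     (of_nat n + 1) * (c + of_nat n) * fps_nth f (Suc n) - (a + of_nat n) * (b + of_nat n) * fps_nth f n"
proof -
  have *: "fps_hyp_op a b c f = fps_X * fps_deriv (fps_deriv f)
     - fps_X * (fps_X * fps_deriv (fps_deriv f)) + fps_const c * fps_deriv f
     - fps_const (a + b + 1) * (fps_X * fps_deriv f) - fps_const (a * b) * f"
    by (simp add: fps_hyp_op_def algebra_simps)
  consider "n = 0" | "n = 1" | m where "n = Suc (Suc m)" 
    by (metis One_nat_def not0_implies_Suc)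
  thus ?thesis
    unfolding * by cases (simp_all add: algebra_simps)
qed

lemma fps_nth_hypergeo_2F1:
  "fps_nth (fps_hypergeo [a, b] [c] 1) n =
     pochhammer a n * pochhammer b n / (pochhammer c n * pochhammer 1 n)"
  by (simp flip: pochhammer_fact)

lemma nonpos_Ints_shift:
  fixes c :: complex
  assumes "c \<notin> \<int>\<^sub>\<le>\<^sub>0"
  shows "c + of_nat N \<notin> \<int>\<^sub>\<le>\<^sub>0"
proof
  assume "c + of_nat N \<in> \<int>\<^sub>\<le>\<^sub>0"
  then obtain m where "c + of_nat N = - of_nat m" by (elim nonpos_Ints_cases')
  hence "c = - of_nat (m + N)" by (simp add: eq_diff_eq[symmetric])
  thus False using assms minus_of_nat_in_nonpos_Ints by metis
qed

lemma shift_nonzero: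
  fixes c :: complex
  assumes "c \<notin> \<int>\<^sub>\<le>\<^sub>0"
  shows "c + of_nat n \<noteq> 0"
  using nonpos_Ints_shift[OF assms, of n] by auto

lemma fps_nth_hypergeo_2F1_Suc:
  "fps_nth (fps_hypergeo [a, b] [c] 1) (Suc n) =
     (a + of_nat n) * (b + of_nat n) / ((c + of_nat n) * (1 + of_nat n)) *
     fps_nth (fps_hypergeo [a, b] [c] 1) n"
  unfolding fps_nth_hypergeo_2F1 pochhammer_Suc by (simp add: mult_ac)

lemma fps_hyp_op_hypergeo:
  assumes "c \<notin> \<int>\<^sub>\<le>\<^sub>0"
  shows "fps_hyp_op a b c (fps_hypergeo [a, b] [c] 1) = 0"
proof (rule fps_ext)
  fix n
  have "c + of_nat n \<noteq> 0" using assms by (rule shift_nonzero)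
  moreover have "1 + of_nat n \<noteq> (0::complex)" by (metis of_nat_Suc of_nat_0_eq_iff nat.simps(3))
  ultimately show "fps_nth (fps_hyp_op a b c (fps_hypergeo [a, b] [c] 1)) n = fps_nth 0 n"
    unfolding fps_nth_hyp_op fps_nth_hypergeo_2F1_Suc
    by (simp add: add.commute del: fps_hypergeo_nth)
qed

lemma fps_hyp_op_eq_0_imp:
  assumes "c \<notin> \<int>\<^sub>\<le>\<^sub>0" "fps_hyp_op a b c f = 0" "fps_nth f 0 = 1"
  shows "f = fps_hypergeo [a, b] [c] 1"
proof (rule fps_ext)
  fix n
  show "fps_nth f n = fps_nth (fps_hypergeo [a, b] [c] 1) n"
  proof (induction n)
    case (Suc n)
    let ?h = "fps_hypergeo [a, b] [c] 1"
    have "(of_nat n + 1) * (c + of_nat n) * fps_nth f (Suc n) =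
          (of_nat n + 1) * (c + of_nat n) * fps_nth ?h (Suc n)"
      using fps_nth_hyp_op[of a b c f n] fps_nth_hyp_op[of a b c ?h n]
        assms(2) fps_hyp_op_hypergeo[OF assms(1), of a b] Suc.IH by simp
    moreover have "(of_nat n + 1) * (c + of_nat n) \<noteq> 0"
      using shift_nonzero[OF assms(1), of n] by (metis add.commute mult_eq_0_iff of_nat_Suc of_nat_0_eq_iff nat.simps(3))
    ultimately show ?case by (metis mult_left_cancel)
  qed (simp add: assms)
qed

text \<open>
  The ratio of consecutive coefficients tends to \<open>1\<close>.  The ratio test is used in the form that also
  covers terminating series, for which the radius is infinite.
\<close>
lemma fps_conv_radius_hypergeo_2F1:
  fixes a b c :: complex
  assumes "c \<notin> \<int>\<^sub>\<le>\<^sub>0"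
  shows "fps_conv_radius (fps_hypergeo [a, b] [c] 1) \<ge> 1"
  unfolding fps_conv_radius_def
proof (rule conv_radius_geI_ex)
  fix r :: real
  assume r: "0 < r" "ereal r < 1"
  let ?h = "fps_nth (fps_hypergeo [a, b] [c] 1)"
  have "(\<lambda>n. norm ((a + of_nat n) * (b + of_nat n) / ((c + of_nat n) * (1 + of_nat n)) * of_real r))
          \<longlonglongrightarrow> norm (1 * complex_of_real r)"
  proof (intro tendsto_intros)
    have lim: "(\<lambda>n. (z + of_nat n) / of_nat n) \<longlonglongrightarrow> 1" for z :: complex
    proof -
      have "(\<lambda>n. z * (1 / of_nat n) + 1) \<longlonglongrightarrow> z * 0 + 1"
        by (intro tendsto_intros lim_1_over_n)
      hence "(\<lambda>n. z * (1 / of_nat n) + 1) \<longlonglongrightarrow> 1" by simp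
      moreover have "eventually (\<lambda>n. z * (1 / of_nat n) + 1 = (z + of_nat n) / of_nat n) sequentially"
        using eventually_gt_at_top[of 0] by eventually_elim (simp add: field_simps)
      ultimately show ?thesis by (rule Lim_transform_eventually)
    qed
    have "(\<lambda>n. ((a + of_nat n) / of_nat n) * ((b + of_nat n) / of_nat n) /
               (((c + of_nat n) / of_nat n) * ((1 + of_nat n) / of_nat n))) \<longlonglongrightarrow> 1 * 1 / (1 * 1)"
      by (intro tendsto_intros lim) auto
    hence "(\<lambda>n. ((a + of_nat n) / of_nat n) * ((b + of_nat n) / of_nat n) /
               (((c + of_nat n) / of_nat n) * ((1 + of_nat n) / of_nat n))) \<longlonglongrightarrow> 1" by simp
    moreover have "eventually (\<lambda>n. ((a + of_nat n) / of_nat n) * ((b + of_nat n) / of_nat n) /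
               (((c + of_nat n) / of_nat n) * ((1 + of_nat n) / of_nat n)) =
               (a + of_nat n) * (b + of_nat n) / ((c + of_nat n) * (1 + of_nat n))) sequentially"
      using eventually_gt_at_top[of 0]
    proof eventually_elim
      case (elim n)
      have "(x / m) * (y / m) / ((z / m) * (w / m)) = x * y / (z * w)" if "m \<noteq> 0" for x y z w m :: complex
        using that by (simp add: divide_simps)
      thus ?case using elim by simp
    qed
    ultimately show "(\<lambda>n. (a + of_nat n) * (b + of_nat n) / ((c + of_nat n) * (1 + of_nat n))) \<longlonglongrightarrow> 1"
      by (rule Lim_transform_eventually)
  qed
  moreover obtain s where s: "r < s" "s < 1" using r dense[of r 1] by auto
  ultimately have "eventually (\<lambda>n. norm ((a + of_nat n) * (b + of_nat n) / ((c + of_nat n) * (1 + of_nat n)) * of_real r) < s) sequentially"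
    using r by (intro order_tendstoD) auto
  then obtain N where N: "\<And>n. n \<ge> N \<Longrightarrow> norm ((a + of_nat n) * (b + of_nat n) / ((c + of_nat n) * (1 + of_nat n)) * of_real r) < s"
    by (auto simp: eventually_sequentially)
  have "summable (\<lambda>n. ?h n * of_real r ^ n)"
  proof (rule summable_ratio_test[where c = s and N = N])
    fix n assume n: "n \<ge> N"
    have "?h (Suc n) * of_real r ^ Suc n =
       ((a + of_nat n) * (b + of_nat n) / ((c + of_nat n) * (1 + of_nat n)) * of_real r) * (?h n * of_real r ^ n)"
      unfolding fps_nth_hypergeo_2F1_Suc by simp
    also have "norm \<dots> \<le> s * norm (?h n * of_real r ^ n)"
      unfolding norm_mult[of _ "?h n * of_real r ^ n"] using N[OF n] by (intro mult_right_mono) auto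
    finally show "norm (?h (Suc n) * of_real r ^ Suc n) \<le> s * norm (?h n * of_real r ^ n)" .
  qed (use s in auto)
  thus "\<exists>z::complex. norm z = r \<and> summable (\<lambda>n. ?h n * z ^ n)"
    using r by (intro exI[of _ "of_real r"]) auto
qed

lemma hyp2F1_at_0: "hyp2F1 a b c 0 = 1"
  by (simp add: hyp2F1_eq_eval_fps eval_fps_at_0 del: fps_hypergeo_nth)

lemma hyp2F1_has_fps_expansion:
  assumes "c \<notin> \<int>\<^sub>\<le>\<^sub>0"
  shows "hyp2F1 a b c has_fps_expansion fps_hypergeo [a, b] [c] 1"
proof -
  have "0 < fps_conv_radius (fps_hypergeo [a, b] [c] 1)"
    using fps_conv_radius_hypergeo_2F1[OF assms, of a b] by (rule less_le_trans[rotated]) simp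
  moreover have "hyp2F1 a b c = eval_fps (fps_hypergeo [a, b] [c] 1)"
    by (auto simp: hyp2F1_eq_eval_fps)
  ultimately show ?thesis
    by (simp add: eval_fps_has_fps_expansion)
qed

lemma hyp2F1_holomorphic:
  assumes "c \<notin> \<int>\<^sub>\<le>\<^sub>0"
  shows "hyp2F1 a b c holomorphic_on ball 0 1"
proof -
  have "eval_fps (fps_hypergeo [a, b] [c] 1) holomorphic_on ball 0 1"
  proof (rule holomorphic_on_eval_fps, rule subsetI)
    fix z :: complex assume "z \<in> ball 0 1"
    hence "ereal (norm z) < 1" by simp
    also note fps_conv_radius_hypergeo_2F1[OF assms, of a b]
    finally show "z \<in> eball 0 (fps_conv_radius (fps_hypergeo [a, b] [c] 1))" by simp
  qed
  moreover have "hyp2F1 a b c = eval_fps (fps_hypergeo [a, b] [c] 1)"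
    by (auto simp: hyp2F1_eq_eval_fps)
  ultimately show ?thesis by simp
qed

lemma has_fps_expansion_hyp_op:
  assumes "G has_fps_expansion g"
  shows "(\<lambda>z. z * (1 - z) * deriv (deriv G) z + (c - (a + b + 1) * z) * deriv G z - a * b * G z)
           has_fps_expansion fps_hyp_op a b c g"
  unfolding fps_hyp_op_def by (intro fps_expansion_intros assms)

text \<open>
  The left-hand side has the zero power series at \<open>0\<close>; the identity theorem extends this to the disc.
\<close>
lemma hyp2F1_ode:
  fixes a b c z :: complex
  assumes c: "c \<notin> \<int>\<^sub>\<le>\<^sub>0" and z: "norm z < 1"
  defines "F \<equiv> hyp2F1 a b c"
  shows "z * (1 - z) * deriv (deriv F) z + (c - (a + b + 1) * z) * deriv F z - a * b * F z = 0"
proof (rule has_fps_expansion_0_analytic_continuation[where A = "ball 0 1" and x = z])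
  show "(\<lambda>z. z * (1 - z) * deriv (deriv F) z + (c - (a + b + 1) * z) * deriv F z - a * b * F z)
          has_fps_expansion 0"
    using has_fps_expansion_hyp_op[OF hyp2F1_has_fps_expansion[OF c, of a b], where a = a and b = b and c = c]
    unfolding F_def fps_hyp_op_hypergeo[OF c] .
  show "(\<lambda>z. z * (1 - z) * deriv (deriv F) z + (c - (a + b + 1) * z) * deriv F z - a * b * F z)
          holomorphic_on ball 0 1"
    unfolding F_def by (intro holomorphic_intros hyp2F1_holomorphic c) auto
qed (use z in auto)

text \<open>
  The second exponent \<open>1 - c\<close> at \<open>0\<close> is not a positive integer, so the coefficient recurrence of the
  equation never degenerates and the analytic solutions form a line.
\<close>
lemma hyp2F1_has_fps_expansionI:
  assumes c: "c \<notin> \<int>\<^sub>\<le>\<^sub>0"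
  assumes G: "G analytic_on {0}" "G 0 = 1"
  assumes ode: "eventually (\<lambda>z. z * (1 - z) * deriv (deriv G) z + (c - (a + b + 1) * z) * deriv G z - a * b * G z = 0) (nhds 0)"
  shows "G has_fps_expansion fps_hypergeo [a, b] [c] 1"
proof -
  define g where "g = fps_expansion G 0"
  have g: "G has_fps_expansion g"
    unfolding g_def using G(1) by (rule analytic_at_imp_has_fps_expansion_0)
  have "(\<lambda>_. 0) has_fps_expansion fps_hyp_op a b c g"
    using has_fps_expansion_hyp_op[OF g, of c a b] by (subst (asm) has_fps_expansion_cong[OF ode refl])
  hence "fps_hyp_op a b c g = 0"
    using fps_expansion_unique_complex has_fps_expansion_0 by blast
  moreover have "fps_nth g 0 = 1"
    using has_fps_expansion_imp_0_eq_fps_nth_0[OF g] G(2) by simp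
  ultimately show ?thesis
    using fps_hyp_op_eq_0_imp[OF c] g by metis
qed

section \<open>Gauss's summation theorem\<close>

definition hyp_coeff :: "complex \<Rightarrow> complex \<Rightarrow> complex \<Rightarrow> nat \<Rightarrow> complex" where
  "hyp_coeff a b c n = pochhammer a n * pochhammer b n / (pochhammer c n * pochhammer 1 n)"

text \<open>
  Exact form of the asymptotics \<open>n^(a + b - c - 1) / (\<Gamma>(a) \<Gamma>(b) / \<Gamma>(c))\<close> of the coefficients: the first
  three factors are the convergents of Gauss's limits for \<open>1/\<Gamma>\<close> and \<open>\<Gamma>\<close>, and are therefore bounded.
\<close>
lemma hyp_coeff_Suc_Gamma_series:
  "of_nat (Suc n) * hyp_coeff a b c (Suc n) =
     rGamma_series a n * rGamma_series b n * Gamma_series c n * exp (- (c - a - b) * of_real (ln (of_nat n)))"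
proof -
  define E where "E = (\<lambda>z. exp (z * complex_of_real (ln (of_nat n))))"
  have E: "E c * E (- (c - a - b)) = E a * E b" unfolding E_def exp_add[symmetric] by (simp add: algebra_simps)
  have nz: "E z \<noteq> 0" for z by (simp add: E_def)
  have "pochhammer 1 (Suc n) = of_nat (Suc n) * (fact n :: complex)"
    by (simp only: pochhammer_fact[symmetric] fact_Suc of_nat_mult)
  hence "of_nat (Suc n) * hyp_coeff a b c (Suc n) =
      pochhammer a (Suc n) * pochhammer b (Suc n) / (pochhammer c (Suc n) * fact n)"
    unfolding hyp_coeff_def by (simp add: field_simps del: of_nat_Suc pochhammer_Suc)
  also have "\<dots> = pochhammer a (Suc n) / (fact n * E a) * (pochhammer b (Suc n) / (fact n * E b)) *
      (fact n / pochhammer c (Suc n)) * (E a * E b)"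
    using nz[of a] nz[of b] by (simp add: field_simps del: pochhammer_Suc)
  also have "\<dots> = rGamma_series a n * rGamma_series b n * Gamma_series c n * E (- (c - a - b))"
    unfolding E[symmetric] by (simp add: rGamma_series_def Gamma_series_def E_def)
  finally show ?thesis by (simp only: E_def)
qed

lemma norm_exp_ln_of_nat:
  assumes "n > 0"
  shows "norm (exp (- z * complex_of_real (ln (of_nat n)))) = of_nat n powr (- Re z)"
  using assms by (simp add: powr_def)

lemma hyp_coeff_times_index_tendsto_0:
  assumes "Re (c - a - b) > 0"
  shows "(\<lambda>n. of_nat n * hyp_coeff a b c n) \<longlonglongrightarrow> 0"
proof -
  have "(\<lambda>n. of_nat n powr (- Re (c - a - b)) :: real) \<longlonglongrightarrow> 0"
    by (intro tendsto_neg_powr filterlim_real_sequentially) (use assms in auto)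
  hence "(\<lambda>n. norm (exp (- (c - a - b) * complex_of_real (ln (of_nat n))))) \<longlonglongrightarrow> 0"
    by (rule Lim_transform_eventually)
       (use eventually_gt_at_top[of 0] in \<open>eventually_elim, metis norm_exp_ln_of_nat\<close>)
  hence "(\<lambda>n. rGamma_series a n * rGamma_series b n * Gamma_series c n * exp (- (c - a - b) * of_real (ln (of_nat n))))
     \<longlonglongrightarrow> rGamma a * rGamma b * Gamma c * 0"
    by (intro tendsto_intros) (rule tendsto_norm_zero_cancel)
  hence "(\<lambda>n. of_nat (Suc n) * hyp_coeff a b c (Suc n)) \<longlonglongrightarrow> 0"
    unfolding hyp_coeff_Suc_Gamma_series by simp
  thus ?thesis by (rule LIMSEQ_imp_Suc)
qed

lemma summable_norm_hyp_coeff: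
  assumes "Re (c - a - b) > 0"
  shows "summable (\<lambda>n. norm (hyp_coeff a b c n))"
proof -
  define \<delta> where "\<delta> = Re (c - a - b)"
  have "convergent (\<lambda>n. rGamma_series a n * rGamma_series b n * Gamma_series c n)"
    by (rule convergentI[of _ "rGamma a * rGamma b * Gamma c"]) (intro tendsto_intros)
  hence "Bseq (\<lambda>n. rGamma_series a n * rGamma_series b n * Gamma_series c n)" by (rule convergent_imp_Bseq)
  then obtain K where K: "K > 0" "\<And>n. norm (rGamma_series a n * rGamma_series b n * Gamma_series c n) \<le> K"
    by (auto simp: Bseq_def)
  have "summable (\<lambda>n. norm (hyp_coeff a b c (Suc n)))"
  proof (rule summable_comparison_test_ev)
    show "summable (\<lambda>n. K * of_nat n powr (- \<delta> - 1))"
      using assms by (intro summable_mult) (simp add: summable_real_powr_iff \<delta>_def)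
    show "eventually (\<lambda>n. norm (norm (hyp_coeff a b c (Suc n))) \<le> K * of_nat n powr (- \<delta> - 1)) sequentially"
      using eventually_gt_at_top[of 0]
    proof eventually_elim
      case (elim n)
      have "of_nat n * norm (hyp_coeff a b c (Suc n)) \<le> norm (of_nat (Suc n) * hyp_coeff a b c (Suc n))"
        unfolding norm_mult norm_of_nat by (intro mult_right_mono) auto
      also have "\<dots> \<le> K * of_nat n powr (- \<delta>)"
        unfolding hyp_coeff_Suc_Gamma_series norm_mult[of _ "exp _"] norm_exp_ln_of_nat[OF elim] \<delta>_def[symmetric]
        by (intro mult_right_mono K) auto
      finally show ?case
        using elim by (simp add: powr_diff field_simps)
    qed
  qed
  thus ?thesis by (subst (asm) summable_Suc_iff)
qed

lemma hyp2F1_at_1: "hyp2F1 a b c 1 = (\<Sum>n. hyp_coeff a b c n)"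
  by (simp add: hyp2F1_def hyp_coeff_def)

text \<open>
  A telescoping certificate for the contiguous relation between \<open>F(a, b; c; 1)\<close> and \<open>F(a, b; c + 1; 1)\<close>.
\<close>
lemma hyp_coeff_contiguous:
  assumes "c \<notin> \<int>\<^sub>\<le>\<^sub>0"
  shows "c * (c - a - b) * hyp_coeff a b c n - (c - a) * (c - b) * hyp_coeff a b (c + 1) n =
     (- c) * (of_nat (Suc n) * hyp_coeff a b c (Suc n)) - (- c) * (of_nat n * hyp_coeff a b c n)"
proof -
  have nz: "c + of_nat n \<noteq> 0" "c \<noteq> 0" using shift_nonzero[OF assms, of n] shift_nonzero[OF assms, of 0] by auto
  have nz1: "1 + of_nat n \<noteq> (0::complex)" by (metis of_nat_0_eq_iff nat.simps(3) of_nat_Suc)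
  have "c * pochhammer (c + 1) n = pochhammer c n * (c + of_nat n)"
    by (metis pochhammer_Suc pochhammer_rec)
  hence p: "pochhammer (c + 1) n = pochhammer c n * (c + of_nat n) / c"
    using nz by (simp add: field_simps)
  define t where "t = hyp_coeff a b c n"
  have s: "hyp_coeff a b (c + 1) n * (c + of_nat n) = c * t"
    unfolding t_def hyp_coeff_def p using nz by (simp add: divide_simps)
  have "of_nat (Suc n) * hyp_coeff a b c (Suc n) = (a + of_nat n) * (b + of_nat n) / (c + of_nat n) * t"
    unfolding t_def hyp_coeff_def pochhammer_Suc using nz nz1 by (simp add: divide_simps)
  hence u: "of_nat (Suc n) * hyp_coeff a b c (Suc n) * (c + of_nat n) = (a + of_nat n) * (b + of_nat n) * t"
    using nz by simp
  define m S U where "m = complex_of_nat n" and "S = hyp_coeff a b (c + 1) n"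
    and "U = of_nat (Suc n) * hyp_coeff a b c (Suc n)"
  have "(c + m) * (c * (c - a - b) * t - (c - a) * (c - b) * S - ((- c) * U - (- c) * (m * t))) = 0"
    using s u unfolding m_def[symmetric] S_def[symmetric] U_def[symmetric] by algebra
  thus ?thesis using nz unfolding m_def S_def U_def t_def by simp
qed

lemma hyp2F1_1_contiguous:
  assumes c: "c \<notin> \<int>\<^sub>\<le>\<^sub>0" and s: "Re (c - a - b) > 0"
  shows "c * (c - a - b) * hyp2F1 a b c 1 = (c - a) * (c - b) * hyp2F1 a b (c + 1) 1"
proof -
  have "(\<lambda>n. (- c) * (of_nat n * hyp_coeff a b c n)) \<longlonglongrightarrow> (- c) * 0"
    by (intro tendsto_intros hyp_coeff_times_index_tendsto_0 s)
  from telescope_sums[OF this]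
  have "(\<lambda>n. c * (c - a - b) * hyp_coeff a b c n - (c - a) * (c - b) * hyp_coeff a b (c + 1) n) sums 0"
    unfolding hyp_coeff_contiguous[OF c] by simp
  moreover have "(\<lambda>n. c * (c - a - b) * hyp_coeff a b c n - (c - a) * (c - b) * hyp_coeff a b (c + 1) n) sums
      (c * (c - a - b) * hyp2F1 a b c 1 - (c - a) * (c - b) * hyp2F1 a b (c + 1) 1)"
    unfolding hyp2F1_at_1 using s
    by (intro sums_diff sums_mult summable_sums summable_norm_cancel[OF summable_norm_hyp_coeff]) auto
  ultimately show ?thesis using sums_unique2 by force
qed

lemma hyp2F1_1_contiguous_iter:
  assumes c: "c \<notin> \<int>\<^sub>\<le>\<^sub>0" and s: "Re (c - a - b) > 0"
  shows "pochhammer c N * pochhammer (c - a - b) N * hyp2F1 a b c 1 =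
         pochhammer (c - a) N * pochhammer (c - b) N * hyp2F1 a b (c + of_nat N) 1"
proof (induction N)
  case (Suc N)
  have "c + of_nat N \<notin> \<int>\<^sub>\<le>\<^sub>0" using c by (rule nonpos_Ints_shift)
  moreover have "Re (c + of_nat N - a - b) > 0" using s by simp
  ultimately have *: "(c + of_nat N) * (c + of_nat N - a - b) * hyp2F1 a b (c + of_nat N) 1 =
      (c + of_nat N - a) * (c + of_nat N - b) * hyp2F1 a b (c + of_nat N + 1) 1"
    by (rule hyp2F1_1_contiguous)
  have "pochhammer c (Suc N) * pochhammer (c - a - b) (Suc N) * hyp2F1 a b c 1 =
     (c + of_nat N) * (c + of_nat N - a - b) * (pochhammer c N * pochhammer (c - a - b) N * hyp2F1 a b c 1)"
    by (simp add: pochhammer_Suc algebra_simps)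
  also have "\<dots> = pochhammer (c - a) N * pochhammer (c - b) N * ((c + of_nat N) * (c + of_nat N - a - b) * hyp2F1 a b (c + of_nat N) 1)"
    unfolding Suc.IH by (simp only: mult_ac)
  also have "\<dots> = (pochhammer (c - a) N * (c - a + of_nat N)) * (pochhammer (c - b) N * (c - b + of_nat N)) * hyp2F1 a b (c + of_nat N + 1) 1"
    unfolding * by (simp add: algebra_simps)
  finally show ?case by (simp add: pochhammer_Suc add_ac)
qed simp

lemma pochhammer_nonneg0: "x \<ge> 0 \<Longrightarrow> pochhammer x n \<ge> 0" for x :: real
  by (induction n) (auto simp: pochhammer_Suc)

lemma pochhammer_mono_arg:
  fixes x y :: real
  assumes "0 \<le> x" "x \<le> y"
  shows "pochhammer x n \<le> pochhammer y n"
  by (induction n) (use assms in \<open>auto simp: pochhammer_Suc intro!: mult_mono pochhammer_nonneg0\<close>)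

lemma norm_pochhammer_le: "norm (pochhammer a n) \<le> pochhammer (norm a) n"
  for a :: complex
proof (induction n)
  case (Suc n)
  have "norm (a + of_nat n) \<le> norm a + of_nat n" by (metis norm_of_nat norm_triangle_ineq)
  thus ?case unfolding pochhammer_Suc norm_mult
    using Suc by (intro mult_mono) (auto intro: pochhammer_nonneg0 order_trans[OF norm_ge_zero])
qed simp

lemma pochhammer_Re_le_norm:
  assumes "Re c > 0"
  shows "pochhammer (Re c) n \<le> norm (pochhammer c n)"
proof (induction n)
  case (Suc n)
  have "Re c + of_nat n \<le> norm (c + of_nat n)" using complex_Re_le_cmod[of "c + of_nat n"] by simp
  thus ?case unfolding pochhammer_Suc norm_mult
    using Suc assms by (intro mult_mono) auto
qed simp

text \<open>
  For \<open>Re d \<ge> \<gamma> > 0\<close> and \<open>n \<ge> 1\<close>, the modulus of \<open>(d, n)\<close> is at least \<open>(Re d / \<gamma>) (\<gamma>, n)\<close>.  Hence all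
  coefficients except the first are \<open>O(1 / Re d)\<close>, uniformly against a fixed summable sequence.
\<close>
lemma hyp2F1_1_tendsto_1:
  "(\<lambda>N. hyp2F1 a b (c + of_nat N) 1) \<longlonglongrightarrow> 1"
proof -
  \<comment> \<open>any value above \<open>norm a + norm b\<close> makes the majorant summable\<close>
  define \<gamma> where "\<gamma> = norm a + norm b + 1"
  have \<gamma>: "\<gamma> > 0" using norm_ge_zero[of a] norm_ge_zero[of b] unfolding \<gamma>_def by linarith
  define T where "T = (\<lambda>n. pochhammer (norm a) n * pochhammer (norm b) n / (pochhammer \<gamma> n * pochhammer 1 n))"
  have "hyp_coeff (of_real (norm a)) (of_real (norm b)) (of_real \<gamma>) n = of_real (T n)" for n
    using pochhammer_of_real[of "1::real" n, where 'a = complex]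
    by (simp add: hyp_coeff_def T_def pochhammer_of_real)
  moreover have T0: "T n \<ge> 0" for n
    unfolding T_def using \<gamma> by (intro divide_nonneg_nonneg mult_nonneg_nonneg pochhammer_nonneg0) auto
  ultimately have "norm (hyp_coeff (of_real (norm a)) (of_real (norm b)) (of_real \<gamma>) n) = T n" for n by simp
  moreover have "summable (\<lambda>n. norm (hyp_coeff (of_real (norm a)) (of_real (norm b)) (of_real \<gamma>) n))"
    by (rule summable_norm_hyp_coeff) (simp add: \<gamma>_def)
  ultimately have sT: "summable T" by simp
  have bound: "norm (hyp2F1 a b d 1 - 1) \<le> \<gamma> * (\<Sum>n. T (Suc n)) / Re d" if d: "Re d \<ge> \<gamma>" for d
  proof -
    have le: "norm (hyp_coeff a b d (Suc n)) \<le> \<gamma> / Re d * T (Suc n)" for n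
    proof -
      have "Re d * pochhammer (\<gamma> + 1) n \<le> Re d * pochhammer (Re d + 1) n"
        using d \<gamma> by (intro mult_left_mono pochhammer_mono_arg) auto
      also have "\<dots> = pochhammer (Re d) (Suc n)" by (simp add: pochhammer_rec)
      also have "\<dots> \<le> norm (pochhammer d (Suc n))" using d \<gamma> by (intro pochhammer_Re_le_norm) auto
      finally have "Re d * pochhammer (\<gamma> + 1) n \<le> norm (pochhammer d (Suc n))" .
      moreover have "Re d * pochhammer (\<gamma> + 1) n = Re d / \<gamma> * pochhammer \<gamma> (Suc n)"
        using \<gamma> by (simp add: pochhammer_rec)
      ultimately have *: "Re d / \<gamma> * pochhammer \<gamma> (Suc n) \<le> norm (pochhammer d (Suc n))" by simp
      have p1: "norm (pochhammer (1::complex) (Suc n)) = pochhammer 1 (Suc n)"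
        by (metis pochhammer_fact norm_fact)
      have "norm (hyp_coeff a b d (Suc n)) =
         norm (pochhammer a (Suc n)) * norm (pochhammer b (Suc n)) / (norm (pochhammer d (Suc n)) * pochhammer 1 (Suc n))"
        by (simp only: hyp_coeff_def norm_mult norm_divide p1)
      also have "\<dots> \<le> pochhammer (norm a) (Suc n) * pochhammer (norm b) (Suc n) /
           (Re d / \<gamma> * pochhammer \<gamma> (Suc n) * pochhammer 1 (Suc n))"
        using d \<gamma> by (intro frac_le mult_mono mult_right_mono mult_pos_pos divide_pos_pos * norm_pochhammer_le pochhammer_pos
            mult_nonneg_nonneg pochhammer_nonneg0 norm_ge_zero less_imp_le[OF pochhammer_pos]) auto
      also have "\<dots> = \<gamma> / Re d * T (Suc n)" by (simp add: T_def mult_ac)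
      finally show ?thesis .
    qed
    have sT': "summable (\<lambda>n. \<gamma> / Re d * T (Suc n))"
      using sT by (intro summable_mult) (subst summable_Suc_iff)
    have s: "summable (\<lambda>n. norm (hyp_coeff a b d (Suc n)))"
      by (rule summable_comparison_test'[OF sT', of 0]) (use le in auto)
    have "hyp2F1 a b d 1 = hyp_coeff a b d 0 + (\<Sum>n. hyp_coeff a b d (Suc n))"
      unfolding hyp2F1_at_1 
      by (subst suminf_split_head) (use summable_norm_cancel[OF s] in \<open>auto simp: summable_Suc_iff\<close>)
    hence "norm (hyp2F1 a b d 1 - 1) = norm (\<Sum>n. hyp_coeff a b d (Suc n))"
      by (simp add: hyp_coeff_def)
    also have "\<dots> \<le> (\<Sum>n. norm (hyp_coeff a b d (Suc n)))" by (rule summable_norm[OF s])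
    also have "\<dots> \<le> (\<Sum>n. \<gamma> / Re d * T (Suc n))" by (intro suminf_le le s sT')
    also have "\<dots> = \<gamma> / Re d * (\<Sum>n. T (Suc n))"
      by (rule suminf_mult) (use sT in \<open>subst summable_Suc_iff\<close>)
    finally show ?thesis by simp
  qed
  have lim: "filterlim (\<lambda>N. Re (c + of_nat N)) at_top sequentially"
    by (simp add: filterlim_tendsto_add_at_top[OF tendsto_const filterlim_real_sequentially])
  have "(\<lambda>N. hyp2F1 a b (c + of_nat N) 1 - 1) \<longlonglongrightarrow> 0"
  proof (rule Lim_null_comparison)
    show "eventually (\<lambda>N. norm (hyp2F1 a b (c + of_nat N) 1 - 1) \<le> \<gamma> * (\<Sum>n. T (Suc n)) / Re (c + of_nat N)) sequentially"
      using lim[unfolded filterlim_at_top, rule_format, of \<gamma>] by eventually_elim (rule bound)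
    show "(\<lambda>N. \<gamma> * (\<Sum>n. T (Suc n)) / Re (c + of_nat N)) \<longlonglongrightarrow> 0"
      by (rule real_tendsto_divide_at_top[OF tendsto_const lim])
  qed
  thus ?thesis by (simp add: LIM_zero_iff)
qed

text \<open>
  Iterating the contiguous relation expresses \<open>F(a, b; c; 1)\<close> through \<open>F(a, b; c + N; 1)\<close>, which tends to
  \<open>1\<close>, and the Pochhammer quotients tend to Gamma quotients: the powers of \<open>n\<close> cancel because
  \<open>(c - a) + (c - b) = c + (c - a - b)\<close>.  The form with \<open>1/\<Gamma>\<close> is valid also when \<open>c - a\<close> or \<open>c - b\<close> is a pole of \<open>\<Gamma>\<close>.
\<close>
theorem Gauss_summation:
  assumes c: "c \<notin> \<int>\<^sub>\<le>\<^sub>0" and s: "Re (c - a - b) > 0"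
  shows "hyp2F1 a b c 1 * (rGamma c * rGamma (c - a - b)) = rGamma (c - a) * rGamma (c - b)"
proof -
  have "hyp2F1 a b c 1 * (rGamma_series c n * rGamma_series (c - a - b) n) =
        rGamma_series (c - a) n * rGamma_series (c - b) n * hyp2F1 a b (c + of_nat (Suc n)) 1" for n
  proof -
    define E where "E = (\<lambda>z. exp (z * complex_of_real (ln (of_nat n))))"
    have E: "E c * E (c - a - b) = E (c - a) * E (c - b)"
      unfolding E_def exp_add[symmetric] by (simp add: algebra_simps)
    have r: "rGamma_series z n = pochhammer z (Suc n) / (fact n * E z)" for z
      by (simp add: rGamma_series_def E_def)
    have "hyp2F1 a b c 1 * (rGamma_series c n * rGamma_series (c - a - b) n) =
       (pochhammer c (Suc n) * pochhammer (c - a - b) (Suc n) * hyp2F1 a b c 1) / (fact n * fact n * (E c * E (c - a - b)))"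
      unfolding r by (simp only: times_divide_times_eq times_divide_eq_right divide_divide_eq_left mult_ac)
    also have "\<dots> = rGamma_series (c - a) n * rGamma_series (c - b) n * hyp2F1 a b (c + of_nat (Suc n)) 1"
      unfolding hyp2F1_1_contiguous_iter[OF c s] E r
      by (simp only: times_divide_times_eq times_divide_eq_right times_divide_eq_left divide_divide_eq_left mult_ac)
    finally show ?thesis .
  qed
  moreover have "(\<lambda>n. hyp2F1 a b c 1 * (rGamma_series c n * rGamma_series (c - a - b) n)) \<longlonglongrightarrow>
          hyp2F1 a b c 1 * (rGamma c * rGamma (c - a - b))"
    by (intro tendsto_intros)
  moreover have "(\<lambda>n. rGamma_series (c - a) n * rGamma_series (c - b) n * hyp2F1 a b (c + of_nat (Suc n)) 1) \<longlonglongrightarrow>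
          rGamma (c - a) * rGamma (c - b) * 1"
    by (intro tendsto_intros LIMSEQ_Suc[OF hyp2F1_1_tendsto_1])
  ultimately show ?thesis using LIMSEQ_unique by fastforce
qed

text \<open>
  Absolute convergence at \<open>1\<close> gives uniform convergence on the closed disc; this replaces Abel's theorem
  in the passage to the boundary point \<open>1\<close>.
\<close>
lemma hyp2F1_continuous_on_cball:
  assumes "Re (c - a - b) > 0"
  shows "continuous_on (cball 0 1) (hyp2F1 a b c)"
proof -
  have "uniform_limit (cball 0 1) (\<lambda>n x. \<Sum>i<n. hyp_coeff a b c i * x ^ i) (\<lambda>x. \<Sum>i. hyp_coeff a b c i * x ^ i) sequentially"
  proof (rule Weierstrass_m_test[OF _ summable_norm_hyp_coeff[OF assms]])
    fix n and x :: complex assume "x \<in> cball 0 1"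
    hence "norm x ^ n \<le> 1" by (intro power_le_one) auto
    thus "norm (hyp_coeff a b c n * x ^ n) \<le> norm (hyp_coeff a b c n)"
      by (simp add: norm_mult norm_power mult_left_le)
  qed
  hence "continuous_on (cball 0 1) (\<lambda>x. \<Sum>i. hyp_coeff a b c i * x ^ i)"
    by (rule uniform_limit_theorem[rotated]) (auto intro!: always_eventually continuous_intros)
  thus ?thesis by (simp add: hyp2F1_def[abs_def] hyp_coeff_def)
qed

section \<open>The quartic transformation\<close>

definition quartic :: "complex \<Rightarrow> complex" where
  "quartic x = 64 * x * (1 - x) ^ 3 / (1 + 8 * x) ^ 3"

lemma one_minus_quartic:
  assumes "1 + 8 * x \<noteq> 0"
  shows "1 - quartic x = (1 - 20 * x - 8 * x ^ 2) ^ 2 / (1 + 8 * x) ^ 3"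
proof -
  have "(1 + 8 * x) ^ 3 - 64 * x * (1 - x) ^ 3 = (1 - 20 * x - 8 * x ^ 2) ^ 2" by algebra
  thus ?thesis using assms by (simp add: quartic_def diff_divide_eq_iff)
qed

definition quartic' :: "complex \<Rightarrow> complex" where
  "quartic' x = 64 * (1 - x) ^ 2 * (1 - 20 * x - 8 * x ^ 2) / (1 + 8 * x) ^ 4"

definition quartic'' :: "complex \<Rightarrow> complex" where
  "quartic'' x = - 3456 * (1 - x) * (1 - 10 * x) / (1 + 8 * x) ^ 5"

lemma DERIV_inverse_linear:
  assumes "1 + 8 * x \<noteq> (0::complex)"
  shows "((\<lambda>x. inverse (1 + 8 * x)) has_field_derivative - 8 * inverse (1 + 8 * x) ^ 2) (at x)"
  using assms by (auto intro!: derivative_eq_intros simp: power2_eq_square)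

lemma quartic_deriv:
  assumes "1 + 8 * x \<noteq> 0"
  shows "(quartic has_field_derivative quartic' x) (at x)"
    and "(quartic' has_field_derivative quartic'' x) (at x)"
proof -
  \<comment> \<open>With \<open>j = 1 / (1 + 8 x)\<close> the claims become polynomial identities modulo \<open>j (1 + 8 x) = 1\<close>.\<close>
  define j :: "complex \<Rightarrow> complex" where "j = (\<lambda>x. inverse (1 + 8 * x))"
  have dj: "(j has_field_derivative - 8 * j x ^ 2) (at x)"
    unfolding j_def by (rule DERIV_inverse_linear[OF assms])
  have j: "j x * (1 + 8 * x) = 1" using assms by (simp add: j_def)
  have e: "quartic = (\<lambda>x. 64 * x * (1 - x) ^ 3 * j x ^ 3)" 
    by (auto simp: quartic_def divide_inverse power_inverse j_def)
  have e': "quartic' = (\<lambda>x. 64 * (1 - x) ^ 2 * (1 - 20 * x - 8 * x ^ 2) * j x ^ 4)" 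
    by (auto simp: quartic'_def divide_inverse power_inverse j_def)
  have e'': "quartic'' = (\<lambda>x. - 3456 * (1 - x) * (1 - 10 * x) * j x ^ 5)" 
    by (auto simp: quartic''_def divide_inverse power_inverse j_def)
  show "(quartic has_field_derivative quartic' x) (at x)"
    unfolding e e'
    apply (rule dj derivative_eq_intros refl)+
    using j
    apply simp
    apply algebra
    done
  show "(quartic' has_field_derivative quartic'' x) (at x)"
    unfolding e' e''
    apply (rule dj derivative_eq_intros refl)+
    using j
    apply simp
    apply algebra
    done
qed

text \<open>
  The next three identities compare the coefficients of \<open>F''\<close>, \<open>F'\<close> and \<open>F\<close>, taken at \<open>\<phi>(x)\<close>, when the
  operator of the parameters \<open>a, a + 1/3, 4/3 - a\<close> is applied to \<open>w(x) F(\<phi>(x))\<close> and \<open>w\<close> is divided out.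
  Each time the result is \<open>64 (1 - x)^2 / (1 + 8 x)^2\<close> times the coefficient in the operator of
  \<open>1/4 - a/2, 7/12 - a/2, 4/3 - a\<close>.  Here \<open>j\<close> and \<open>k\<close> stand for \<open>1 / (1 + 8 x)\<close> and \<open>1 / (1 - x)\<close>, and
  \<open>l\<close> for the logarithmic derivative of \<open>w\<close>.
\<close>
lemma quartic_second_order_identity:
  fixes x j :: complex
  assumes "j * (1 + 8 * x) = 1"
  shows "x * (1 - x) * (64 * (1 - x)^2 * (1 - 20*x - 8*x^2) * j^4)^2 = 
    64 * (1 - x)^2 * j^2 * ((64 * x * (1 - x)^3 * j^3) * (1 - 64 * x * (1 - x)^3 * j^3))"
proof -
  have "1 - 64 * x * (1 - x)^3 * j^3 = (1 - 20*x - 8*x^2)^2 * j^3"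
    using assms by algebra
  then show ?thesis by algebra
qed

lemma quartic_first_order_identity:
  fixes x j k a :: complex
  assumes "j * (1 + 8 * x) = 1" "k * (1 - x) = 1"
  defines "l \<equiv> (3 * a - 1) * k + (12 * a - 6) * j"
  shows "x * (1 - x) * (2 * l * (64 * (1 - x)^2 * (1 - 20*x - 8*x^2) * j^4) + - 3456 * (1 - x) * (1 - 10*x) * j^5)
    + ((4/3 - a) - (a + (a + 1/3) + 1) * x) * (64 * (1 - x)^2 * (1 - 20*x - 8*x^2) * j^4)
    = 64 * (1 - x)^2 * j^2 * ((4/3 - a) - ((1/4 - a/2) + (7/12 - a/2) + 1) * (64 * x * (1 - x)^3 * j^3))"
  using assms(1,2) unfolding l_def by algebra

lemma quartic_zeroth_order_identity:
  fixes x j k a :: complex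
  assumes "j * (1 + 8 * x) = 1" "k * (1 - x) = 1"
  defines "l \<equiv> (3 * a - 1) * k + (12 * a - 6) * j"
  shows "x * (1 - x) * (l^2 + ((3*a-1) * k^2 - 8 * (12*a-6) * j^2))
    + ((4/3 - a) - (a + (a + 1/3) + 1) * x) * l - a * (a + 1/3) = - (64 * (1 - x)^2 * j^2) * ((1/4 - a/2) * (7/12 - a/2))"
  using assms(1,2) unfolding l_def by algebra

text \<open>
  The first factor moves the exponents \<open>0, 3 a - 1\<close> at \<open>x = 1\<close> to \<open>1 - 3 a, 0\<close>.  The second compensates
  the exponent \<open>3 (1/4 - a/2)\<close> that the triple pole of \<open>\<phi>\<close> creates at \<open>x = -1/8\<close>.
\<close>
definition weight :: "complex \<Rightarrow> complex \<Rightarrow> complex" where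
  "weight a x = (1 - x) powr (1 - 3 * a) * (1 + 8 * x) powr (3 * a / 2 - 3 / 4)"

definition weight_logderiv :: "complex \<Rightarrow> complex \<Rightarrow> complex" where
  "weight_logderiv a x = (3 * a - 1) * inverse (1 - x) + (12 * a - 6) * inverse (1 + 8 * x)"

lemma not_nonpos_Reals:
  fixes x :: complex
  assumes "x \<in> ball 0 (1/8)"
  shows "1 - x \<notin> \<real>\<^sub>\<le>\<^sub>0" "1 + 8 * x \<notin> \<real>\<^sub>\<le>\<^sub>0"
proof -
  have "\<bar>Re x\<bar> < 1/8" using assms abs_Re_le_cmod[of x] by simp
  thus "1 - x \<notin> \<real>\<^sub>\<le>\<^sub>0" "1 + 8 * x \<notin> \<real>\<^sub>\<le>\<^sub>0"
    by (auto simp: complex_nonpos_Reals_iff)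
qed

lemma weight_deriv:
  assumes "x \<in> ball 0 (1/8)"
  shows "(weight a has_field_derivative weight a x * weight_logderiv a x) (at x)"
proof -
  note nz = not_nonpos_Reals[OF assms]
  have d1: "((\<lambda>x. Ln (1 - x)) has_field_derivative inverse (1 - x) * (- 1)) (at x)"
    by (rule DERIV_chain2[where f = Ln and g = "\<lambda>x. 1 - x"], rule has_field_derivative_Ln[OF nz(1)])
       (auto intro!: derivative_eq_intros)
  have d2: "((\<lambda>x. Ln (1 + 8 * x)) has_field_derivative inverse (1 + 8 * x) * 8) (at x)"
    by (rule DERIV_chain2[where f = Ln and g = "\<lambda>x. 1 + 8 * x"], rule has_field_derivative_Ln[OF nz(2)])
       (auto intro!: derivative_eq_intros)
  have "(1 - 3 * a) * (inverse (1 - x) * (- 1)) + (3 * a / 2 - 3 / 4) * (inverse (1 + 8 * x) * 8)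
          = weight_logderiv a x"
    unfolding weight_logderiv_def by algebra
  hence "((\<lambda>x. exp ((1 - 3 * a) * Ln (1 - x) + (3 * a / 2 - 3 / 4) * Ln (1 + 8 * x)))
     has_field_derivative
       exp ((1 - 3 * a) * Ln (1 - x) + (3 * a / 2 - 3 / 4) * Ln (1 + 8 * x)) * weight_logderiv a x) (at x)"
    using DERIV_chain2[where f = exp and g = "\<lambda>x. (1 - 3 * a) * Ln (1 - x) + (3 * a / 2 - 3 / 4) * Ln (1 + 8 * x)", OF DERIV_exp DERIV_add[OF DERIV_cmult[OF d1, of "1 - 3 * a"] DERIV_cmult[OF d2, of "3 * a / 2 - 3 / 4"]]] by metis
  moreover have e: "exp ((1 - 3 * a) * Ln (1 - y) + (3 * a / 2 - 3 / 4) * Ln (1 + 8 * y)) = weight a y"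
    if "y \<in> ball 0 (1/8)" for y
  proof -
    have "1 - y \<noteq> 0" "1 + 8 * y \<noteq> 0" using not_nonpos_Reals[OF that] by auto
    thus ?thesis by (simp add: weight_def powr_def exp_add)
  qed
  ultimately show ?thesis
    unfolding e[OF assms] by (rule has_field_derivative_transform_within_open[OF _ open_ball assms]) (use e in simp)
qed

lemma weight_logderiv_deriv:
  assumes "x \<in> ball 0 (1/8)"
  shows "(weight_logderiv a has_field_derivative
           (3 * a - 1) * inverse (1 - x) ^ 2 - 8 * (12 * a - 6) * inverse (1 + 8 * x) ^ 2) (at x)"
proof -
  have nz': "1 - x \<noteq> 0" "1 + 8 * x \<noteq> 0" using not_nonpos_Reals[OF assms] by auto
  have "((\<lambda>x. (3 * a - 1) * inverse (1 - x) + (12 * a - 6) * inverse (1 + 8 * x)) has_field_derivative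
           (3 * a - 1) * inverse (1 - x) ^ 2 - 8 * (12 * a - 6) * inverse (1 + 8 * x) ^ 2) (at x)"
    by (rule derivative_eq_intros refl nz')+ (simp add: algebra_simps power2_eq_square)
  thus ?thesis by (simp add: weight_logderiv_def[abs_def])
qed

text \<open>
  The disc avoids the branch points \<open>1\<close> and \<open>-1/8\<close> of the weight; the norm condition keeps \<open>\<phi>(x)\<close> inside
  the disc of convergence.  The set need not be connected.
\<close>
definition quartic_dom :: "complex set" where
  "quartic_dom = {x \<in> ball 0 (1/8). norm (quartic x) < 1}"

lemma quartic_holomorphic: "quartic holomorphic_on ball 0 (1/8)"
proof -
  have "1 + 8 * x \<noteq> 0" if "x \<in> ball 0 (1/8)" for x :: complex
    using not_nonpos_Reals[OF that] by auto
  thus ?thesis unfolding quartic_def[abs_def] by (intro holomorphic_intros) auto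
qed

lemma open_quartic_dom: "open quartic_dom"
proof -
  have "open (ball 0 (1/8) \<inter> quartic -` ball 0 1)"
    by (intro continuous_open_preimage holomorphic_on_imp_continuous_on quartic_holomorphic) auto
  also have "ball 0 (1/8) \<inter> quartic -` ball 0 1 = quartic_dom"
    by (auto simp: quartic_dom_def)
  finally show ?thesis .
qed

lemma zero_in_quartic_dom: "0 \<in> quartic_dom"
  by (simp add: quartic_dom_def quartic_def)

definition pullback :: "complex \<Rightarrow> complex \<Rightarrow> complex" where
  "pullback a x = weight a x * hyp2F1 (1/4 - a/2) (7/12 - a/2) (4/3 - a) (quartic x)"

lemma ode_collect:
  fixes x W L L' p p' f f1 f2 r s :: complex
  shows "x * (1 - x) * (W * ((L ^ 2 + L') * f + (2 * L * p + p') * f1 + p ^ 2 * f2))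
           + r * (W * (L * f + p * f1)) - s * (W * f) =
         W * ((x * (1 - x) * (L ^ 2 + L') + r * L - s) * f
           + (x * (1 - x) * (2 * L * p + p') + r * p) * f1 + x * (1 - x) * p ^ 2 * f2)"
  by algebra

lemma pullback_ode:
  assumes c: "4/3 - a \<notin> \<int>\<^sub>\<le>\<^sub>0" and x: "x \<in> quartic_dom"
  defines "G \<equiv> pullback a"
  shows "G field_differentiable (at x)"
    and "x * (1 - x) * deriv (deriv G) x + ((4/3 - a) - (a + (a + 1/3) + 1) * x) * deriv G x
           - a * (a + 1/3) * G x = 0"
proof -
  define F where "F = hyp2F1 (1/4 - a/2) (7/12 - a/2) (4/3 - a)"
  define W where "W = weight a"
  define L where "L = weight_logderiv a"
  define L' where "L' = (\<lambda>x. (3 * a - 1) * inverse (1 - x) ^ 2 - 8 * (12 * a - 6) * inverse (1 + 8 * x) ^ 2)"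
  define G1 where "G1 = (\<lambda>x. W x * (L x * F (quartic x) + quartic' x * deriv F (quartic x)))"
  define G2 where "G2 = (\<lambda>x. W x * ((L x ^ 2 + L' x) * F (quartic x)
     + (2 * L x * quartic' x + quartic'' x) * deriv F (quartic x)
     + quartic' x ^ 2 * deriv (deriv F) (quartic x)))"
  have F: "F holomorphic_on ball 0 1" unfolding F_def by (rule hyp2F1_holomorphic[OF c])
  have F': "deriv F holomorphic_on ball 0 1" by (intro holomorphic_intros F) auto
  have G: "(G has_field_derivative G1 x) (at x)" and G1: "(G1 has_field_derivative G2 x) (at x)"
    if "x \<in> quartic_dom" for x
  proof -
    have x: "x \<in> ball 0 (1/8)" and qx: "quartic x \<in> ball 0 1" using that by (auto simp: quartic_dom_def)
    have nz: "1 + 8 * x \<noteq> 0" using not_nonpos_Reals[OF x] by auto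
    have dF: "(F has_field_derivative deriv F (quartic x)) (at (quartic x))"
      by (rule holomorphic_derivI[OF F _ qx]) auto
    have dF': "(deriv F has_field_derivative deriv (deriv F) (quartic x)) (at (quartic x))"
      by (rule holomorphic_derivI[OF F' _ qx]) auto
    have dL: "(L has_field_derivative L' x) (at x)"
      using weight_logderiv_deriv[OF x, of a] by (simp add: L_def L'_def)
    note d = weight_deriv[OF x, of a, folded W_def L_def] dL
      DERIV_chain2[OF dF quartic_deriv(1)[OF nz]] DERIV_chain2[OF dF' quartic_deriv(1)[OF nz]] quartic_deriv[OF nz]
    have G': "G = (\<lambda>x. W x * F (quartic x))" by (auto simp: G_def pullback_def W_def F_def)
    show "(G has_field_derivative G1 x) (at x)"
      unfolding G' G1_def by (rule DERIV_cong, (rule DERIV_mult' d)+) algebra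
    show "(G1 has_field_derivative G2 x) (at x)"
      unfolding G1_def G2_def
      by (rule DERIV_cong, (rule DERIV_mult' DERIV_add d)+)
         algebra
  qed
  from G[OF x] show "G field_differentiable (at x)" by (auto simp: field_differentiable_def)
  have "deriv G x = G1 x" using G[OF x] by (rule DERIV_imp_deriv)
  moreover have "deriv (deriv G) x = G2 x"
  proof -
    have "eventually (\<lambda>x. deriv G x = G1 x) (nhds x)"
      using eventually_nhds_in_open[OF open_quartic_dom x] by eventually_elim (rule DERIV_imp_deriv[OF G])
    hence "deriv (deriv G) x = deriv G1 x" by (intro deriv_cong_ev) auto
    also have "\<dots> = G2 x" using G1[OF x] by (rule DERIV_imp_deriv)
    finally show ?thesis .
  qed
  moreover have "x * (1 - x) * G2 x + ((4/3 - a) - (a + (a + 1/3) + 1) * x) * G1 x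
           - a * (a + 1/3) * G x = 0"
  proof -
    have xb: "x \<in> ball 0 (1/8)" and qx: "norm (quartic x) < 1" using x by (auto simp: quartic_dom_def)
    have nz: "1 + 8 * x \<noteq> 0" "1 - x \<noteq> 0" using not_nonpos_Reals[OF xb] by auto
    define j where "j = inverse (1 + 8 * x)"
    define k where "k = inverse (1 - x)"
    have j: "j * (1 + 8 * x) = 1" and k: "k * (1 - x) = 1" using nz by (auto simp: j_def k_def)
    have q: "quartic x = 64 * x * (1 - x)^3 * j^3" 
        "quartic' x = 64 * (1 - x)^2 * (1 - 20*x - 8*x^2) * j^4"
        "quartic'' x = - 3456 * (1 - x) * (1 - 10*x) * j^5"
      by (simp_all add: quartic_def quartic'_def quartic''_def j_def divide_inverse power_inverse)
    have L: "L x = (3 * a - 1) * k + (12 * a - 6) * j"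
        "L' x = (3 * a - 1) * k^2 - 8 * (12 * a - 6) * j^2"
      by (simp_all add: L_def weight_logderiv_def L'_def j_def k_def)
    define M where "M = 64 * (1 - x)^2 * j^2"
    have i2: "x * (1 - x) * quartic' x ^ 2 = M * (quartic x * (1 - quartic x))"
      unfolding q M_def by (rule quartic_second_order_identity[OF j])
    have i1: "x * (1 - x) * (2 * L x * quartic' x + quartic'' x) + ((4/3 - a) - (a + (a + 1/3) + 1) * x) * quartic' x
       = M * ((4/3 - a) - ((1/4 - a/2) + (7/12 - a/2) + 1) * quartic x)"
      unfolding q L M_def by (rule quartic_first_order_identity[OF j k])
    have i0: "x * (1 - x) * (L x ^ 2 + L' x) + ((4/3 - a) - (a + (a + 1/3) + 1) * x) * L x
       - a * (a + 1/3) = - M * ((1/4 - a/2) * (7/12 - a/2))"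
      unfolding q L M_def by (rule quartic_zeroth_order_identity[OF j k])
    have ode: "quartic x * (1 - quartic x) * deriv (deriv F) (quartic x)
        + ((4/3 - a) - ((1/4 - a/2) + (7/12 - a/2) + 1) * quartic x) * deriv F (quartic x)
        - (1/4 - a/2) * (7/12 - a/2) * F (quartic x) = 0"
      unfolding F_def by (rule hyp2F1_ode[OF c qx])
    have "x * (1 - x) * G2 x + ((4/3 - a) - (a + (a + 1/3) + 1) * x) * G1 x - a * (a + 1/3) * G x =
      W x * ((x * (1 - x) * (L x ^ 2 + L' x) + ((4/3 - a) - (a + (a + 1/3) + 1) * x) * L x
       - a * (a + 1/3)) * F (quartic x) + 
      (x * (1 - x) * (2 * L x * quartic' x + quartic'' x) + ((4/3 - a) - (a + (a + 1/3) + 1) * x) * quartic' x)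
        * deriv F (quartic x) + x * (1 - x) * quartic' x ^ 2 * deriv (deriv F) (quartic x))"
      unfolding G1_def G2_def G_def pullback_def F_def[symmetric] W_def[symmetric] by (rule ode_collect)
    also have "\<dots> = W x * M * (quartic x * (1 - quartic x) * deriv (deriv F) (quartic x)
        + ((4/3 - a) - ((1/4 - a/2) + (7/12 - a/2) + 1) * quartic x) * deriv F (quartic x)
        - (1/4 - a/2) * (7/12 - a/2) * F (quartic x))"
      unfolding i0 i1 i2 by algebra
    also have "\<dots> = 0" unfolding ode by simp
    finally show ?thesis .
  qed
  ultimately show "x * (1 - x) * deriv (deriv G) x + ((4/3 - a) - (a + (a + 1/3) + 1) * x) * deriv G x
           - a * (a + 1/3) * G x = 0" by simp
qed

section \<open>Evaluation at the root\<close>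

definition x0 :: real where "x0 = - 5/4 + 3/4 * sqrt 3"

lemma x0_bounds: "0 < x0" "x0 < 1/8"
proof -
  have "sqrt ((5/3)\<^sup>2) < sqrt 3" by (rule real_sqrt_less_mono) (simp add: power2_eq_square)
  moreover have "sqrt 3 < sqrt ((11/6)\<^sup>2)" by (rule real_sqrt_less_mono) (simp add: power2_eq_square)
  ultimately have "5/3 < sqrt 3" "sqrt 3 < 11/6" by simp_all
  thus "0 < x0" "x0 < 1/8" unfolding x0_def by simp_all
qed

lemma x0_root: "1 - 20 * x0 - 8 * x0 ^ 2 = 0"
  unfolding x0_def by (simp add: power2_eq_square algebra_simps)

lemma quartic_of_real:
  fixes x :: real
  assumes "0 \<le> x" "x \<le> x0"
  shows "norm (quartic (of_real x)) = 1 - (1 - 20 * x - 8 * x ^ 2) ^ 2 / (1 + 8 * x) ^ 3"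
proof -
  have "1 + 8 * complex_of_real x = of_real (1 + 8 * x)" by simp
  moreover have "1 + 8 * x \<noteq> 0" using assms by simp
  ultimately have nz: "1 + 8 * complex_of_real x \<noteq> 0" by (metis of_real_eq_0_iff)
  have q: "quartic (of_real x) = of_real (64 * x * (1 - x) ^ 3 / (1 + 8 * x) ^ 3)"
    by (simp add: quartic_def)
  have "of_real (1 - (1 - 20 * x - 8 * x ^ 2) ^ 2 / (1 + 8 * x) ^ 3) = quartic (of_real x)"
    using one_minus_quartic[OF nz] by (simp add: algebra_simps)
  hence "64 * x * (1 - x) ^ 3 / (1 + 8 * x) ^ 3 = 1 - (1 - 20 * x - 8 * x ^ 2) ^ 2 / (1 + 8 * x) ^ 3"
    unfolding q by (metis of_real_eq_iff)
  moreover have "64 * x * (1 - x) ^ 3 / (1 + 8 * x) ^ 3 \<ge> 0"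
    using assms x0_bounds by (intro divide_nonneg_nonneg mult_nonneg_nonneg) auto
  ultimately show ?thesis unfolding q norm_of_real by simp
qed

lemma quartic_x0: "quartic (of_real x0) = 1"
proof -
  have "1 + 8 * complex_of_real x0 = of_real (1 + 8 * x0)" by simp
  moreover have "1 + 8 * x0 \<noteq> 0" using x0_bounds by simp
  ultimately have nz: "1 + 8 * complex_of_real x0 \<noteq> 0" by (metis of_real_eq_0_iff)
  have "1 - 20 * complex_of_real x0 - 8 * of_real x0 ^ 2 = of_real (1 - 20 * x0 - 8 * x0 ^ 2)" by simp
  thus ?thesis using one_minus_quartic[OF nz] unfolding x0_root by simp
qed

lemma interval_in_quartic_dom:
  assumes "0 \<le> x" "x < x0"
  shows "of_real x \<in> quartic_dom"
proof -
  have "x ^ 2 < x0 ^ 2" using assms by (intro power_strict_mono) auto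
  hence "0 < 1 - 20 * x - 8 * x ^ 2" using x0_root assms by linarith
  hence "0 < (1 - 20 * x - 8 * x ^ 2) ^ 2 / (1 + 8 * x) ^ 3" using assms by simp
  hence "norm (quartic (of_real x)) < 1" using quartic_of_real[of x] assms by simp
  thus ?thesis using assms x0_bounds by (simp add: quartic_dom_def)
qed

text \<open>
  On the whole disc \<open>|x| < x0\<close> the values of \<open>\<phi>\<close> leave the unit disc, for example at negative \<open>x\<close>.  The
  continuation therefore runs in the component of \<open>0\<close> in the domain, which contains the segment.
\<close>
lemma hyp2F1_eq_pullback:
  assumes c: "4/3 - a \<notin> \<int>\<^sub>\<le>\<^sub>0" and x: "0 \<le> x" "x < x0"
  shows "hyp2F1 a (a + 1/3) (4/3 - a) (of_real x) = pullback a (of_real x)"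
proof -
  let ?H = "hyp2F1 a (a + 1/3) (4/3 - a)"
  define U where "U = connected_component_set quartic_dom 0"
  have U: "open U" "connected U" "U \<subseteq> quartic_dom" 
    unfolding U_def by (auto simp: open_connected_component open_quartic_dom connected_component_subset)
  have 0: "0 \<in> U" unfolding U_def using zero_in_quartic_dom by simp
  have hol: "pullback a holomorphic_on quartic_dom"
    using pullback_ode(1)[OF c] open_quartic_dom
    by (auto simp: holomorphic_on_def field_differentiable_at_within)
  have "pullback a analytic_on {0}"
    using hol open_quartic_dom zero_in_quartic_dom by (auto simp: analytic_at)
  moreover have "pullback a 0 = 1" by (simp add: pullback_def weight_def quartic_def hyp2F1_at_0)
  moreover have "eventually (\<lambda>z. z * (1 - z) * deriv (deriv (pullback a)) z +
      ((4/3 - a) - (a + (a + 1/3) + 1) * z) * deriv (pullback a) z - a * (a + 1/3) * pullback a z = 0) (nhds 0)"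
    using eventually_nhds_in_open[OF open_quartic_dom zero_in_quartic_dom]
    by eventually_elim (rule pullback_ode(2)[OF c])
  ultimately have "pullback a has_fps_expansion fps_hypergeo [a, a + 1/3] [4/3 - a] 1"
    by (rule hyp2F1_has_fps_expansionI[OF c])
  hence "(\<lambda>z. ?H z - pullback a z) has_fps_expansion 
      (fps_hypergeo [a, a + 1/3] [4/3 - a] 1 - fps_hypergeo [a, a + 1/3] [4/3 - a] 1)"
    by (intro fps_expansion_intros hyp2F1_has_fps_expansion[OF c])
  hence e: "(\<lambda>z. ?H z - pullback a z) has_fps_expansion 0" by simp
  have "?H (of_real x) - pullback a (of_real x) = 0"
  proof (rule has_fps_expansion_0_analytic_continuation[OF e _ U(1,2) 0])
    have "quartic_dom \<subseteq> ball 0 1" by (auto simp: quartic_dom_def)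
    thus "(\<lambda>z. ?H z - pullback a z) holomorphic_on U"
      using U(3) by (intro holomorphic_intros holomorphic_on_subset[OF hol] holomorphic_on_subset[OF hyp2F1_holomorphic[OF c]]) auto
    have "complex_of_real ` {0..<x0} \<subseteq> U"
      unfolding U_def
    proof (rule connected_component_maximal)
      show "0 \<in> complex_of_real ` {0..<x0}" using x0_bounds by (auto intro!: image_eqI[of _ _ 0])
      show "connected (complex_of_real ` {0..<x0})"
        by (intro connected_continuous_image continuous_intros) auto
      show "complex_of_real ` {0..<x0} \<subseteq> quartic_dom" using interval_in_quartic_dom by auto
    qed
    thus "of_real x \<in> U" using x by auto
  qed
  thus ?thesis by simp
qed

lemma hyp2F1_at_x0:
  assumes c: "4/3 - a \<notin> \<int>\<^sub>\<le>\<^sub>0"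
  shows "hyp2F1 a (a + 1/3) (4/3 - a) (of_real x0) =
           weight a (of_real x0) * hyp2F1 (1/4 - a/2) (7/12 - a/2) (4/3 - a) 1"
proof -
  let ?H = "hyp2F1 a (a + 1/3) (4/3 - a)" and ?K = "hyp2F1 (1/4 - a/2) (7/12 - a/2) (4/3 - a)"
  have cl: "closure {0..<x0} = {0..x0}" using x0_bounds by simp
  have sub: "complex_of_real ` {0..x0} \<subseteq> ball 0 (1/8)" using x0_bounds by auto
  have h: "continuous_on {0..x0} (\<lambda>x. ?H (of_real x))"
    using sub by (intro continuous_on_compose2[OF holomorphic_on_imp_continuous_on[OF hyp2F1_holomorphic[OF c]]] continuous_intros) fastforce
  have whol: "weight a holomorphic_on ball 0 (1/8)"
    unfolding holomorphic_on_open[OF open_ball] by (intro ballI exI) (rule weight_deriv)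
  have w: "continuous_on {0..x0} (\<lambda>x. weight a (of_real x))"
    using sub by (intro continuous_on_compose2[OF holomorphic_on_imp_continuous_on[OF whol]] continuous_intros)
  have q: "continuous_on {0..x0} (\<lambda>x. quartic (of_real x))"
    using sub by (intro continuous_on_compose2[OF holomorphic_on_imp_continuous_on[OF quartic_holomorphic]] continuous_intros)
  have "norm (quartic (of_real x)) \<le> 1" if "x \<in> {0..x0}" for x
    using quartic_of_real[of x] that by simp
  hence k: "continuous_on {0..x0} (\<lambda>x. ?K (quartic (of_real x)))"
    by (intro continuous_on_compose2[OF hyp2F1_continuous_on_cball q]) auto
  have "?H (of_real x0) - weight a (of_real x0) * ?K (quartic (of_real x0)) = 0"
  proof (rule continuous_constant_on_closure[where S = "{0..<x0}" and f = "\<lambda>x. ?H (of_real x) - weight a (of_real x) * ?K (quartic (of_real x))"])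
    show "continuous_on (closure {0..<x0}) (\<lambda>x. ?H (of_real x) - weight a (of_real x) * ?K (quartic (of_real x)))"
      unfolding cl by (intro continuous_intros h w k)
    show "?H (of_real x) - weight a (of_real x) * ?K (quartic (of_real x)) = 0" if "x \<in> {0..<x0}" for x
      using hyp2F1_eq_pullback[OF c, of x] that by (simp add: pullback_def)
    show "x0 \<in> closure {0..<x0}" unfolding cl using x0_bounds by simp
  qed
  thus ?thesis by (simp add: quartic_x0)
qed

text \<open>
  Gauss's theorem gives \<open>\<Gamma>(4/3 - a) \<Gamma>(1/2)\<close> in the numerator; the duplication formula splits it into
  \<open>\<Gamma>(2/3 - a/2) \<Gamma>(7/6 - a/2)\<close>, up to a power of \<open>2\<close>.
\<close>
lemma quartic_side_at_1:
  assumes c: "4/3 - a \<notin> \<int>\<^sub>\<le>\<^sub>0"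
  shows "hyp2F1 (1/4 - a/2) (7/12 - a/2) (4/3 - a) 1 =
     exp ((1/3 - a) * of_real (ln 2)) * Gamma (2/3 - a/2) * Gamma (7/6 - a/2) *
     rGamma (3/4 - a/2) * rGamma (13/12 - a/2)"
proof -
  have half: "(4/3 - a) - (1/4 - a/2) - (7/12 - a/2) = 1/2"
    "(4/3 - a) - (1/4 - a/2) = 13/12 - a/2" "(4/3 - a) - (7/12 - a/2) = 3/4 - a/2" by algebra+
  have gauss: "hyp2F1 (1/4 - a/2) (7/12 - a/2) (4/3 - a) 1 * (rGamma (4/3 - a) * rGamma (1/2)) =
      rGamma (13/12 - a/2) * rGamma (3/4 - a/2)"
    using Gauss_summation[OF c, of "1/4 - a/2" "7/12 - a/2"] unfolding half by simp
  have n1: "2/3 - a/2 \<notin> \<int>\<^sub>\<le>\<^sub>0"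
  proof
    assume "2/3 - a/2 \<in> \<int>\<^sub>\<le>\<^sub>0"
    then obtain n where "2/3 - a/2 = - of_nat n" by (elim nonpos_Ints_cases')
    hence "4/3 - a = - of_nat (2 * n)" by (simp add: field_simps)
    thus False using c minus_of_nat_in_nonpos_Ints by metis
  qed
  have n2: "2/3 - a/2 + 1/2 \<notin> \<int>\<^sub>\<le>\<^sub>0"
  proof
    assume "2/3 - a/2 + 1/2 \<in> \<int>\<^sub>\<le>\<^sub>0"
    then obtain n where "2/3 - a/2 + 1/2 = - of_nat n" by (elim nonpos_Ints_cases')
    hence "4/3 - a = - of_nat (2 * n + 1)" by (simp add: field_simps)
    thus False using c minus_of_nat_in_nonpos_Ints by metis
  qed
  have s: "2/3 - a/2 + 1/2 = 7/6 - a/2" "2 * (2/3 - a/2) = 4/3 - a" "1 - (4/3 - a) = a - 1/3" by algebra+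
  have dup: "Gamma (2/3 - a/2) * Gamma (7/6 - a/2) = exp ((a - 1/3) * of_real (ln 2)) * of_real (sqrt pi) * Gamma (4/3 - a)"
    using Gamma_legendre_duplication[OF n1 n2] unfolding s .
  have e: "exp ((1/3 - a) * of_real (ln 2)) * exp ((a - 1/3) * of_real (ln 2)) = (1 :: complex)"
    unfolding exp_add[symmetric] by (simp add: algebra_simps)
  have g: "Gamma (4/3 - a) * rGamma (4/3 - a) = 1"
    using c by (simp add: rGamma_inverse_Gamma Gamma_eq_zero_iff)
  have "rGamma (1/2 :: complex) * of_real (sqrt pi) = 1"
    by (simp add: rGamma_inverse_Gamma Gamma_one_half_complex)
  hence "hyp2F1 (1/4 - a/2) (7/12 - a/2) (4/3 - a) 1 =
     hyp2F1 (1/4 - a/2) (7/12 - a/2) (4/3 - a) 1 * (rGamma (4/3 - a) * rGamma (1/2)) * (of_real (sqrt pi) * Gamma (4/3 - a))"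
    using g by algebra
  also have "\<dots> = exp ((1/3 - a) * of_real (ln 2)) * (Gamma (2/3 - a/2) * Gamma (7/6 - a/2)) *
     (rGamma (3/4 - a/2) * rGamma (13/12 - a/2))"
    unfolding gauss dup using e by algebra
  finally show ?thesis by (simp only: mult_ac)
qed

lemma ln_x0: "(3/2) * ln (1 + 8 * x0) - 3 * ln (1 - x0) - ln 2 = (7/2) * ln 2 - (9/4) * ln 3"
proof -
  have pos: "1 + 8 * x0 > 0" "1 - x0 > 0" using x0_bounds by auto
  have "3 * sqrt 3 * (1 + 8 * x0) = 8 * (1 - x0) ^ 2"
    unfolding x0_def by (simp add: power2_eq_square algebra_simps)
  hence "ln (3 * sqrt 3 * (1 + 8 * x0)) = ln (8 * (1 - x0) ^ 2)" by simp
  moreover have "ln (3 * sqrt 3 * (1 + 8 * x0)) = ln 3 + ln 3 / 2 + ln (1 + 8 * x0)"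
    using pos by (simp add: ln_mult ln_sqrt)
  moreover have "ln (8 * (1 - x0) ^ 2) = 3 * ln 2 + 2 * ln (1 - x0)"
  proof -
    have "ln (8::real) = ln (2 ^ 3)" by simp
    also have "\<dots> = 3 * ln 2" by (subst ln_realpow) auto
    finally show ?thesis using pos by (simp add: ln_mult ln_realpow)
  qed
  ultimately show ?thesis by simp
qed

text \<open>
  The dependence on \<open>a\<close> of the algebraic factors is purely exponential; the terms at \<open>a = 0\<close> are left
  unevaluated since the case \<open>a = 0\<close> of the final formula determines their product.
\<close>
lemma weight_x0:
  "weight a (of_real x0) * exp ((1/3 - a) * of_real (ln 2)) =
     weight 0 (of_real x0) * exp (1/3 * of_real (ln 2)) * (3 powr (- 9 * a / 4) / 2 powr (- 7 * a / 2))"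
proof -
  define u v where "u = complex_of_real (ln (1 - x0))" and "v = complex_of_real (ln (1 + 8 * x0))"
  define l2 l3 where "l2 = complex_of_real (ln 2)" and "l3 = complex_of_real (ln 3)"
  have pos: "1 + 8 * x0 > 0" "1 - x0 > 0" using x0_bounds by auto
  have nz: "1 - complex_of_real x0 \<noteq> 0" "1 + 8 * complex_of_real x0 \<noteq> 0"
    using pos not_nonpos_Reals[of "of_real x0"] x0_bounds by auto
  have "Ln (of_real (1 - x0)) = u" "Ln (of_real (1 + 8 * x0)) = v"
    unfolding u_def v_def using pos by (simp_all only: Ln_of_real)
  hence w: "weight a (of_real x0) = exp ((1 - 3 * a) * u + (3 * a / 2 - 3 / 4) * v)" for a
    using nz by (simp add: weight_def powr_def exp_add)
  have "complex_of_real ((3/2) * ln (1 + 8 * x0) - 3 * ln (1 - x0) - ln 2) = of_real ((7/2) * ln 2 - (9/4) * ln 3)"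
    unfolding ln_x0 ..
  hence l: "(3/2) * v - 3 * u - l2 = (7/2) * l2 - (9/4) * l3"
    by (simp add: u_def v_def l2_def l3_def)
  have p: "(3::complex) powr (- 9 * a / 4) = exp (- 9 * a / 4 * l3)" "(2::complex) powr (- 7 * a / 2) = exp (- 7 * a / 2 * l2)"
    using Ln_of_real[of 3] Ln_of_real[of 2] by (simp_all add: powr_def l2_def l3_def)
  have "weight a (of_real x0) * exp ((1/3 - a) * l2) = exp (((1 - 3 * a) * u + (3 * a / 2 - 3 / 4) * v) + (1/3 - a) * l2)"
    unfolding w exp_add ..
  also have "((1 - 3 * a) * u + (3 * a / 2 - 3 / 4) * v) + (1/3 - a) * l2 =
     ((1 - 3 * 0) * u + (3 * 0 / 2 - 3 / 4) * v) + 1/3 * l2 + (- 9 * a / 4 * l3 - (- 7 * a / 2 * l2))"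
    using l by algebra
  also have "exp \<dots> = weight 0 (of_real x0) * exp (1/3 * l2) * (exp (- 9 * a / 4 * l3) / exp (- 7 * a / 2 * l2))"
    unfolding exp_add exp_diff w ..
  finally show ?thesis unfolding p l2_def[symmetric] .
qed

lemma hyp2F1_at_x0_Gamma:
  assumes c: "4/3 - a \<notin> \<int>\<^sub>\<le>\<^sub>0"
  shows "hyp2F1 a (a + 1/3) (4/3 - a) (of_real x0) =
     weight 0 (of_real x0) * exp (1/3 * of_real (ln 2)) * (3 powr (- 9 * a / 4) / 2 powr (- 7 * a / 2)) *
     Gamma (2/3 - a/2) * Gamma (7/6 - a/2) * rGamma (3/4 - a/2) * rGamma (13/12 - a/2)"
  unfolding hyp2F1_at_x0[OF c] quartic_side_at_1[OF c] weight_x0[symmetric] by (simp only: mult_ac)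

theorem mainTheorem19:
  fixes a :: complex
  assumes "4/3 - a \<notin> \<int>\<^sub>\<le>\<^sub>0"
  shows "hyp2F1 a (a + 1/3) (4/3 - a) (of_real (- 5/4 + 3/4 * sqrt 3)) =
           (3 powr (- 9 * a / 4) * Gamma (3/4) * Gamma (13/12)
              * Gamma (2/3 - a/2) * Gamma (7/6 - a/2))
           / (2 powr (- 7 * a / 2) * Gamma (2/3) * Gamma (7/6))
           * rGamma (3/4 - a/2) * rGamma (13/12 - a/2)"
proof -
  have g: "Gamma (of_real x :: complex) \<noteq> 0" if "x > 0" for x :: real
    using that by (simp add: Gamma_eq_zero_iff of_real_in_nonpos_Ints_iff) (use nonpos_Ints_nonpos in force)
  have g: "Gamma (2/3 :: complex) \<noteq> 0" "Gamma (7/6 :: complex) \<noteq> 0" "Gamma (3/4 :: complex) \<noteq> 0" "Gamma (13/12 :: complex) \<noteq> 0"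
    using g[of "2/3"] g[of "7/6"] g[of "3/4"] g[of "13/12"] by simp_all
  have "(of_real (4/3) :: complex) \<notin> \<int>\<^sub>\<le>\<^sub>0"
    unfolding of_real_in_nonpos_Ints_iff using nonpos_Ints_nonpos[of "4/3::real"] by auto
  hence c0: "4/3 - (0::complex) \<notin> \<int>\<^sub>\<le>\<^sub>0" by simp
  \<comment> \<open>the series for \<open>a = 0\<close> fixes the remaining constant\<close>
  have "pochhammer (0::complex) n = (if n = 0 then 1 else 0)" for n by (simp add: pochhammer_0_left)
  hence "hyp2F1 0 (0 + 1/3) (4/3 - 0) (of_real x0) = (\<Sum>n. if n = 0 then 1 else 0)"
    unfolding hyp2F1_def by (intro suminf_cong) simp
  also have "\<dots> = (1 :: complex)" by (subst suminf_finite[of "{0}"]) auto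
  finally have "weight 0 (of_real x0) * exp (1/3 * of_real (ln 2)) * (Gamma (2/3) * Gamma (7/6) * rGamma (3/4) * rGamma (13/12)) = 1"
    unfolding hyp2F1_at_x0_Gamma[OF c0] by (simp add: mult_ac)
  hence K: "weight 0 (of_real x0) * exp (1/3 * of_real (ln 2)) = Gamma (3/4) * Gamma (13/12) / (Gamma (2/3) * Gamma (7/6))"
    using g by (simp add: rGamma_inverse_Gamma field_simps)
  show ?thesis
    using hyp2F1_at_x0_Gamma[OF assms] unfolding K unfolding x0_def by (simp add: mult_ac)
qed

end
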